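(* Let $y\in W^{1,1}(0,T;Y)$. Then $y$ solves $$\partial\psi(y'(t))+Ay(t)\ni \ell(t)\quad\text{for a.e. } t\in(0,T),\qquad y(0)=y_0,$$ if and only if $F(y)=0=\min F$.
   Context: Let $T>0$ and let $Y$ be a separable reflexive real Banach space with norm $|\cdot|$, dual $Y^*$, and duality pairing $\langle\cdot,\cdot\rangle$ between $Y^*$ and $Y$. Let $\psi:Y\to[0,\infty]$ be proper, convex, lower semicontinuous and positively $1$-homogeneous; $C=D(\psi)=\{y:\psi(y)<\infty\}$; $\partial\psi$ is the subdifferential of convex analysis, and $\psi^*(w)=\sup_{v\in Y}(\langle w,v\rangle-\psi(v))$ is the conjugate, i.e. the indicator function of the closed convex set $C^*=\partial\psi(0)\subset Y^*$. Let $A:Y\to Y^*$ be linear, continuous and symmetric, $\phi(y)=\frac12\langle Ay,y\rangle$, and assume there is $\alpha>0$ with $\phi(y)\ge\frac{\alpha}{2}|y|^2$ for all $y\in C$. Let $\chi(y)=\phi(y)+|y|^2$, and assume $\chi\ge 0$ on $Y$ with $\chi(y)=0$ iff $y=0$. Let $\ell\in L^\infty(0,T;Y^* )$ and $y_0\in C$. Define $L(t,y,p)=\psi(p)+\psi^*(\ell(t)-Ay)-\langle \ell(t)-Ay,p\rangle$ and $F:W^{1,1}(0,T;Y)\to[0,\infty]$ by $$F(y)=\int_0^T L(t,y(t),y'(t))\,dt+\chi(y(0)-y_0).$$ *)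

theory Defs
  imports "HOL-Analysis.Analysis"
begin

type_synonym 'a dual = "'a \<Rightarrow>\<^sub>L real"

text \<open>Reflexivity: every element of the bidual is evaluation at a point of the space.\<close>

definition reflexive_space :: "'a::real_normed_vector itself \<Rightarrow> bool" where
  "reflexive_space _ \<longleftrightarrow> (\<forall>\<Phi> :: 'a dual dual. \<exists>y::'a. \<forall>w. blinfun_apply \<Phi> w = blinfun_apply w y)"


section \<open>Convex analysis of extended-real-valued functions\<close>

definition ereal_proper :: "('a \<Rightarrow> ereal) \<Rightarrow> bool" where
  "ereal_proper f \<longleftrightarrow> (\<forall>v. f v \<noteq> -\<infinity>) \<and> (\<exists>v. f v < \<infinity>)"

definition ereal_convex :: "('a::real_vector \<Rightarrow> ereal) \<Rightarrow> bool" where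
  "ereal_convex f \<longleftrightarrow> (\<forall>u v. \<forall>t::real. 0 < t \<and> t < 1 \<longrightarrow>
     f ((1 - t) *\<^sub>R u + t *\<^sub>R v) \<le> ereal (1 - t) * f u + ereal t * f v)"

definition ereal_lsc :: "('a::topological_space \<Rightarrow> ereal) \<Rightarrow> bool" where
  "ereal_lsc f \<longleftrightarrow> (\<forall>x. f x \<le> Liminf (at x) f)"

definition pos_homogeneous :: "('a::real_vector \<Rightarrow> ereal) \<Rightarrow> bool" where
  "pos_homogeneous f \<longleftrightarrow> (\<forall>c::real. \<forall>v. 0 < c \<longrightarrow> f (c *\<^sub>R v) = ereal c * f v)"

definition eff_domain :: "('a \<Rightarrow> ereal) \<Rightarrow> 'a set" where
  "eff_domain f = {v. f v < \<infinity>}"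

definition subdiff :: "('a::real_normed_vector \<Rightarrow> ereal) \<Rightarrow> 'a \<Rightarrow> 'a dual set" where
  "subdiff f u = {w. u \<in> eff_domain f \<and> (\<forall>v. f u + ereal (blinfun_apply w (v - u)) \<le> f v)}"

definition conjugate :: "('a::real_normed_vector \<Rightarrow> ereal) \<Rightarrow> 'a dual \<Rightarrow> ereal" where
  "conjugate f w = (SUP v. ereal (blinfun_apply w v) - f v)"


section \<open>Spaces of vector-valued functions on the interval\<close>

text \<open>Bochner (strong) measurability. It is spelled out because the library provides no
  second-countable topology on the dual space, so that the Bochner integral and the usual
  facts about \<open>borel_measurable\<close> are not available there.\<close>

definition strongly_measurable :: "'b measure \<Rightarrow> ('b \<Rightarrow> 'a::topological_space) \<Rightarrow> bool" where
  "strongly_measurable M f \<longleftrightarrow>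
     (\<exists>s. (\<forall>n::nat. simple_function M (s n)) \<and> (AE x in M. (\<lambda>n. s n x) \<longlonglongrightarrow> f x))"

definition Linfty :: "real \<Rightarrow> (real \<Rightarrow> 'a::real_normed_vector) set" where
  "Linfty T = {f. strongly_measurable (lebesgue_on {0<..<T}) f \<and>
                  (\<exists>K. AE t in lebesgue_on {0<..<T}. norm (f t) \<le> K)}"

text \<open>Real-valued functions in the class of smooth functions with compact support in \<open>(0,T)\<close>.\<close>

definition test_function :: "real \<Rightarrow> (real \<Rightarrow> real) \<Rightarrow> bool" where
  "test_function T \<eta> \<longleftrightarrow> (\<forall>n::nat. \<forall>x. (deriv ^^ n) \<eta> differentiable (at x)) \<and>
     closure {x. \<eta> x \<noteq> 0} \<subseteq> {0<..<T}"

definition has_weak_deriv ::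
    "real \<Rightarrow> (real \<Rightarrow> 'a::{banach, second_countable_topology}) \<Rightarrow> (real \<Rightarrow> 'a) \<Rightarrow> bool" where
  "has_weak_deriv T y g \<longleftrightarrow>
     integrable (lebesgue_on {0<..<T}) y \<and> integrable (lebesgue_on {0<..<T}) g \<and>
     (\<forall>\<eta>. test_function T \<eta> \<longrightarrow>
        (\<integral>t. deriv \<eta> t *\<^sub>R y t \<partial>lebesgue_on {0<..<T}) = - (\<integral>t. \<eta> t *\<^sub>R g t \<partial>lebesgue_on {0<..<T}))"

text \<open>Every class in \<open>W\<^sup>1\<^sup>,\<^sup>1(0,T;Y)\<close> has exactly one representative that is continuous on
  \<open>[0,T]\<close>; as usual it is identified with that representative, which gives \<open>y 0\<close> a meaning.
  Values outside \<open>[0,T]\<close> are irrelevant.\<close>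

definition W11 :: "real \<Rightarrow> (real \<Rightarrow> 'a::{banach, second_countable_topology}) set" where
  "W11 T = {y. continuous_on {0..T} y \<and> (\<exists>g. has_weak_deriv T y g)}"

text \<open>The derivative \<open>y'\<close>; weak derivatives are unique up to null sets.\<close>

definition weak_deriv ::
    "real \<Rightarrow> (real \<Rightarrow> 'a::{banach, second_countable_topology}) \<Rightarrow> real \<Rightarrow> 'a" where
  "weak_deriv T y = (SOME g. has_weak_deriv T y g)"

text \<open>Lebesgue integral of an extended-real-valued function as positive part minus negative
  part, so that nonnegativity of an integral is not built in by truncation.\<close>

definition ereal_integral :: "'b measure \<Rightarrow> ('b \<Rightarrow> ereal) \<Rightarrow> ereal" where
  "ereal_integral M f =
     enn2ereal (\<integral>\<^sup>+ x. e2ennreal (f x) \<partial>M) - enn2ereal (\<integral>\<^sup>+ x. e2ennreal (- f x) \<partial>M)"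


section \<open>The rate-independent evolution and its Brezis--Ekeland--Nayroles functional\<close>

definition energy :: "('a::real_normed_vector \<Rightarrow>\<^sub>L 'a dual) \<Rightarrow> 'a \<Rightarrow> real" where
  "energy A y = 1 / 2 * blinfun_apply (blinfun_apply A y) y"

definition initial_penalty :: "('a::real_normed_vector \<Rightarrow>\<^sub>L 'a dual) \<Rightarrow> 'a \<Rightarrow> real" where
  "initial_penalty A y = energy A y + (norm y)\<^sup>2"

definition lagrangian ::
    "('a::real_normed_vector \<Rightarrow> ereal) \<Rightarrow> ('a \<Rightarrow>\<^sub>L 'a dual) \<Rightarrow> (real \<Rightarrow> 'a dual) \<Rightarrow>
     real \<Rightarrow> 'a \<Rightarrow> 'a \<Rightarrow> ereal" where
  "lagrangian \<psi> A l t y p =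
     \<psi> p + conjugate \<psi> (l t - blinfun_apply A y) -
     ereal (blinfun_apply (l t - blinfun_apply A y) p)"

definition BEN_functional ::
    "real \<Rightarrow> ('a::{banach, second_countable_topology} \<Rightarrow> ereal) \<Rightarrow> ('a \<Rightarrow>\<^sub>L 'a dual) \<Rightarrow>
     (real \<Rightarrow> 'a dual) \<Rightarrow> 'a \<Rightarrow> (real \<Rightarrow> 'a) \<Rightarrow> ereal" where
  "BEN_functional T \<psi> A l y0 y =
     ereal_integral (lebesgue_on {0<..<T}) (\<lambda>t. lagrangian \<psi> A l t (y t) (weak_deriv T y t)) +
     ereal (initial_penalty A (y 0 - y0))"

definition solves_evolution ::
    "real \<Rightarrow> ('a::{banach, second_countable_topology} \<Rightarrow> ereal) \<Rightarrow> ('a \<Rightarrow>\<^sub>L 'a dual) \<Rightarrow>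
     (real \<Rightarrow> 'a dual) \<Rightarrow> 'a \<Rightarrow> (real \<Rightarrow> 'a) \<Rightarrow> bool" where
  "solves_evolution T \<psi> A l y0 y \<longleftrightarrow>
     (AE t in lebesgue_on {0<..<T}.
        l t \<in> {\<xi> + blinfun_apply A (y t) | \<xi>. \<xi> \<in> subdiff \<psi> (weak_deriv T y t)}) \<and>
     y 0 = y0"

end

theory Submission
  imports Defs
begin

text \<open>The Lagrangian is nonnegative by the Fenchel--Young inequality, and it vanishes at
  \<open>(t, y, p)\<close> exactly when \<open>l t - A y \<in> \<partial>\<psi>(p)\<close>. Hence the functional is a sum of two
  nonnegative terms, which vanishes if and only if both do. Since the integral of a non-measurable
  function may vanish without the function being null, the measurability of the Lagrangian along a
  trajectory matters: it holds because the conjugate is a supremum over a countable dense subset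
  of the epigraph of \<open>\<psi>\<close>.\<close>

section \<open>Fenchel--Young\<close>

text \<open>Testing the supremum in the conjugate at \<open>p\<close> gives the bound. The point
  \<open>u\<close>, where \<open>\<psi>\<close> is finite, keeps the conjugate away from
  -\<infinity>, so the sum never has the form \<infinity> - \<infinity>.\<close>

lemma fenchel_young:
  assumes "\<And>v. 0 \<le> \<psi> v" and "\<psi> u < \<infinity>"
  shows "0 \<le> \<psi> p + conjugate \<psi> w - ereal (blinfun_apply w p)"
proof -
  have le: "ereal (blinfun_apply w v) - \<psi> v \<le> conjugate \<psi> w" for v
    unfolding conjugate_def by (rule SUP_upper) simp
  have "conjugate \<psi> w \<noteq> -\<infinity>"
    using le[of u] assms(1)[of u] assms(2) by (cases "\<psi> u") auto
  then show ?thesis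
    using le[of p] assms(1)[of p] by (cases "\<psi> p"; cases "conjugate \<psi> w") auto
qed

text \<open>Equality means that the supremum in the conjugate is finite and attained at
  \<open>p\<close>; comparing the value at \<open>p\<close> with that at any \<open>v\<close> and
  rearranging is the subgradient inequality.\<close>

lemma fenchel_young_eq_iff_subdiff:
  assumes nonneg: "\<And>v. 0 \<le> \<psi> v" and fin: "\<psi> u < \<infinity>"
  shows "\<psi> p + conjugate \<psi> w - ereal (blinfun_apply w p) = 0 \<longleftrightarrow> w \<in> subdiff \<psi> p"
proof
  assume eq: "\<psi> p + conjugate \<psi> w - ereal (blinfun_apply w p) = 0"
  have le: "ereal (blinfun_apply w v) - \<psi> v \<le> conjugate \<psi> w" for v
    unfolding conjugate_def by (rule SUP_upper) simp
  \<comment> \<open>An infinite \<open>\<psi> p\<close> would make the left side of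
    \<open>eq\<close> infinite, since \<infinity> absorbs every other summand in
    \<open>ereal\<close>.\<close>
  obtain r where r: "\<psi> p = ereal r"
    using eq nonneg[of p] by (cases "\<psi> p") auto
  have c: "conjugate \<psi> w = ereal (blinfun_apply w p - r)"
    using eq r by (cases "conjugate \<psi> w") auto
  have "\<psi> p + ereal (blinfun_apply w (v - p)) \<le> \<psi> v" for v
    using le[of v] nonneg[of v] c r by (cases "\<psi> v") (auto simp: blinfun.diff_right)
  then show "w \<in> subdiff \<psi> p"
    by (simp add: subdiff_def eff_domain_def r)
next
  assume w: "w \<in> subdiff \<psi> p"
  then obtain r where r: "\<psi> p = ereal r"
    using nonneg[of p] by (cases "\<psi> p") (auto simp: subdiff_def eff_domain_def)
  have "ereal (blinfun_apply w v) - \<psi> v \<le> ereal (blinfun_apply w p - r)" for v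
  proof -
    have "\<psi> p + ereal (blinfun_apply w (v - p)) \<le> \<psi> v"
      using w by (simp add: subdiff_def)
    then show ?thesis
      using r nonneg[of v] by (cases "\<psi> v") (auto simp: blinfun.diff_right)
  qed
  then have "conjugate \<psi> w \<le> ereal (blinfun_apply w p - r)"
    unfolding conjugate_def by (rule SUP_least)
  then have "\<psi> p + conjugate \<psi> w - ereal (blinfun_apply w p) \<le> 0"
    using r by (cases "conjugate \<psi> w") auto
  then show "\<psi> p + conjugate \<psi> w - ereal (blinfun_apply w p) = 0"
    using fenchel_young[of \<psi> u, OF nonneg fin] by (rule antisym)
qed


section \<open>Measurability\<close>

text \<open>One point of \<open>S\<close> is chosen in each basic open set that meets
  \<open>S\<close>. Intersecting a countable dense subset of the whole space with \<open>S\<close>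
  would not do, as \<open>S\<close> may have empty interior.\<close>

lemma countable_dense_subset_exists:
  fixes S :: "'a::second_countable_topology set"
  obtains D where "countable D" "D \<subseteq> S" "S \<subseteq> closure D"
proof -
  obtain B :: "'a set set" where B: "countable B" "topological_basis B"
    using ex_countable_basis by blast
  define D where "D = (\<lambda>U. SOME x. x \<in> U \<inter> S) ` {U \<in> B. U \<inter> S \<noteq> {}}"
  have pick: "(SOME x. x \<in> U \<inter> S) \<in> U \<inter> S" if "U \<inter> S \<noteq> {}" for U
    using that by (metis ex_in_conv someI_ex)
  have "x \<in> closure D" if "x \<in> S" for x
    unfolding closure_iff_nhds_not_empty
  proof (intro allI impI)
    fix V W :: "'a set"
    assume "W \<subseteq> V" "open W" "x \<in> W"
    then obtain U where U: "U \<in> B" "x \<in> U" "U \<subseteq> W"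
      using topological_basisE[OF B(2)] by metis
    then have "U \<inter> S \<noteq> {}" using that by auto
    then have "(SOME x. x \<in> U \<inter> S) \<in> D \<inter> V"
      using pick[of U] U \<open>W \<subseteq> V\<close> by (auto simp: D_def)
    then show "D \<inter> V \<noteq> {}" by auto
  qed
  moreover have "countable D" unfolding D_def using B(1) by auto
  moreover have "D \<subseteq> S" unfolding D_def using pick by auto
  ultimately show thesis using that by blast
qed

text \<open>The conjugate is the supremum of \<open>(v, r) \<mapsto> w v - r\<close> over the
  epigraph. This map is continuous even where \<open>\<psi>\<close> is not, so a dense subset of the
  epigraph yields the same supremum, and one \<open>D\<close> serves all \<open>w\<close>.\<close>

lemma conjugate_eq_countable_SUP:
  fixes \<psi> :: "'a::{real_normed_vector, second_countable_topology} \<Rightarrow> ereal"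
  assumes "\<And>v. \<psi> v \<noteq> -\<infinity>"
  obtains D :: "('a \<times> real) set" where "countable D"
    "\<And>w. conjugate \<psi> w = (SUP x\<in>D. ereal (blinfun_apply w (fst x) - snd x))"
proof -
  obtain D where D: "countable D" "D \<subseteq> {x. \<psi> (fst x) \<le> ereal (snd x)}"
    "{x. \<psi> (fst x) \<le> ereal (snd x)} \<subseteq> closure D"
    by (rule countable_dense_subset_exists)
  have "conjugate \<psi> w = (SUP x\<in>D. ereal (blinfun_apply w (fst x) - snd x))" (is "_ = ?S") for w
  proof (rule antisym)
    \<comment> \<open>A bound by \<open>?S\<close> is a closed condition, so it passes from
      \<open>D\<close> to its closure and hence to the whole epigraph.\<close>
    have "closed {x. ereal (blinfun_apply w (fst x) - snd x) \<le> ?S}"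
      by (intro closed_Collect_le continuous_intros)
    then have "closure D \<subseteq> {x. ereal (blinfun_apply w (fst x) - snd x) \<le> ?S}"
      by (rule closure_minimal[rotated]) (auto intro: SUP_upper)
    then have *: "ereal (blinfun_apply w v - r) \<le> ?S" if "\<psi> v \<le> ereal r" for v r
    proof -
      have "(v, r) \<in> closure D" using D(3) that by auto
      with \<open>closure D \<subseteq> _\<close> have "(v, r) \<in> {x. ereal (blinfun_apply w (fst x) - snd x) \<le> ?S}" ..
      then show ?thesis by simp
    qed
    have "ereal (blinfun_apply w v) - \<psi> v \<le> ?S" for v
      using *[of v] assms[of v] by (cases "\<psi> v") auto
    then show "conjugate \<psi> w \<le> ?S"
      unfolding conjugate_def by (rule SUP_least)
    show "?S \<le> conjugate \<psi> w"
    proof (rule SUP_least)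
      fix x assume "x \<in> D"
      then have "\<psi> (fst x) \<le> ereal (snd x)" using D(2) by auto
      then have "ereal (blinfun_apply w (fst x) - snd x) \<le> ereal (blinfun_apply w (fst x)) - \<psi> (fst x)"
        using assms[of "fst x"] by (cases "\<psi> (fst x)") auto
      also have "\<dots> \<le> conjugate \<psi> w"
        unfolding conjugate_def by (rule SUP_upper) simp
      finally show "ereal (blinfun_apply w (fst x) - snd x) \<le> conjugate \<psi> w" .
    qed
  qed
  with D(1) that show thesis by blast
qed

text \<open>Measurability of \<open>w\<close> against fixed vectors suffices, because only countably
  many vectors enter the supremum.\<close>

lemma borel_measurable_conjugate:
  fixes \<psi> :: "'a::{real_normed_vector, second_countable_topology} \<Rightarrow> ereal"
  assumes "\<And>v. \<psi> v \<noteq> -\<infinity>"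
    and [measurable]: "\<And>v. (\<lambda>t. blinfun_apply (w t) v) \<in> borel_measurable M"
  shows "(\<lambda>t. conjugate \<psi> (w t)) \<in> borel_measurable M"
proof -
  obtain D :: "('a \<times> real) set" where [simp]: "countable D"
    and D: "\<And>w. conjugate \<psi> w = (SUP x\<in>D. ereal (blinfun_apply w (fst x) - snd x))"
    using conjugate_eq_countable_SUP[of \<psi>] assms(1) by blast
  show ?thesis unfolding D by measurable
qed

lemma borel_measurable_ereal_lsc:
  fixes f :: "'a::topological_space \<Rightarrow> ereal"
  assumes "ereal_lsc f"
  shows "f \<in> borel_measurable borel"
proof (rule borel_measurableI_greater)
  fix a
  have "open {x. a < f x}"
  proof (subst open_subopen, safe)
    fix x assume ax: "a < f x"
    also have "f x \<le> Liminf (at x) f" using assms by (simp add: ereal_lsc_def)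
    finally have "\<forall>\<^sub>F z in at x. a < f z" by (rule less_LiminfD)
    \<comment> \<open>The filter \<open>at x\<close> omits \<open>x\<close> itself;
      \<open>ax\<close> supplies the missing point.\<close>
    then obtain U where "open U" "x \<in> U" "\<forall>z\<in>U. z \<noteq> x \<longrightarrow> a < f z"
      unfolding eventually_at_topological by blast
    with ax show "\<exists>U. open U \<and> x \<in> U \<and> U \<subseteq> {x. a < f x}"
      by (intro exI[of _ U]) auto
  qed
  then show "{x \<in> space borel. a < f x} \<in> sets borel" by simp
qed

text \<open>Approximating \<open>p\<close> by simple functions reduces the claim to fixed vectors on
  finitely many level sets; continuity of each \<open>w t\<close> then passes to the limit.\<close>

lemma borel_measurable_blinfun_apply_weak:
  fixes p :: "'b \<Rightarrow> 'a::{real_normed_vector, second_countable_topology}"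
  assumes w: "\<And>v. (\<lambda>t. blinfun_apply (w t) v :: real) \<in> borel_measurable M"
    and p: "p \<in> borel_measurable M"
  shows "(\<lambda>t. blinfun_apply (w t) (p t)) \<in> borel_measurable M"
proof -
  obtain s where s: "\<And>n::nat. simple_function M (s n)"
      "\<And>t. t \<in> space M \<Longrightarrow> (\<lambda>n. s n t) \<longlonglongrightarrow> p t"
    using borel_measurable_implies_sequence_metric[OF p, of 0] by blast
  show ?thesis
  proof (rule borel_measurable_LIMSEQ_metric)
    fix n
    show "(\<lambda>t. blinfun_apply (w t) (s n t)) \<in> borel_measurable M"
    proof (rule measurable_compose_countable'[where I = "s n ` space M"])
      show "s n \<in> measurable M (count_space (s n ` space M))"
        using s(1) unfolding simple_function_def
        by (intro measurable_count_space_eq2[THEN iffD2]) auto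
      show "countable (s n ` space M)"
        using s(1) by (simp add: simple_function_def countable_finite)
    qed (rule w)
  next
    fix t assume "t \<in> space M"
    then show "(\<lambda>n. blinfun_apply (w t) (s n t)) \<longlonglongrightarrow> blinfun_apply (w t) (p t)"
      by (intro tendsto_intros s)
  qed
qed

text \<open>Setting \<open>l\<close> and its simple approximants to 0 on a measurable null set turns
  almost everywhere convergence into convergence everywhere, which evaluation at \<open>v\<close>
  preserves.\<close>

lemma strongly_measurable_AE_eq_weak:
  fixes l :: "'b \<Rightarrow> 'a::real_normed_vector dual"
  assumes "strongly_measurable M l"
  obtains g where "\<And>v. (\<lambda>t. blinfun_apply (g t) v) \<in> borel_measurable M" "AE t in M. g t = l t"
proof -
  obtain s where s: "\<And>n::nat. simple_function M (s n)" "AE t in M. (\<lambda>n. s n t) \<longlonglongrightarrow> l t"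
    using assms by (auto simp: strongly_measurable_def)
  obtain N where N: "N \<in> sets M" "emeasure M N = 0" "{t \<in> space M. \<not> (\<lambda>n. s n t) \<longlonglongrightarrow> l t} \<subseteq> N"
    using s(2) by (rule AE_E) auto
  define g where "g t = (if t \<in> N then 0 else l t)" for t
  have "(\<lambda>t. blinfun_apply (g t) v) \<in> borel_measurable M" for v
  proof (rule borel_measurable_LIMSEQ_metric)
    fix n
    have "simple_function M (\<lambda>t. blinfun_apply (s n t) v)"
      by (rule simple_function_compose1[OF s(1), of "\<lambda>x. blinfun_apply x v"])
    then have "(\<lambda>t. blinfun_apply (s n t) v) \<in> borel_measurable M"
      by (rule borel_measurable_simple_function)
    then show "(\<lambda>t. if t \<in> N then 0 else blinfun_apply (s n t) v) \<in> borel_measurable M"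
      using N(1) by measurable
  next
    fix t assume "t \<in> space M"
    then show "(\<lambda>n. if t \<in> N then 0 else blinfun_apply (s n t) v) \<longlonglongrightarrow> blinfun_apply (g t) v"
      using N(3) by (auto simp: g_def intro!: tendsto_intros)
  qed
  moreover have "AE t in M. g t = l t"
    using AE_not_in[of N M] N by (auto simp: g_def null_sets_def)
  ultimately show thesis using that by blast
qed

text \<open>\<open>G\<close> is the Lagrangian with \<open>l\<close> replaced by its weakly
  measurable version; each of the three summands is then covered by a lemma above.\<close>

lemma lagrangian_AE_eq_measurable:
  fixes \<psi> :: "'a::{banach, second_countable_topology} \<Rightarrow> ereal"
  assumes "\<And>v. 0 \<le> \<psi> v" and "ereal_lsc \<psi>" and "strongly_measurable M l"
    and [measurable]: "y \<in> borel_measurable M" "p \<in> borel_measurable M"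
  obtains G where "G \<in> borel_measurable M" "AE t in M. G t = lagrangian \<psi> A l t (y t) (p t)"
proof -
  obtain g where [measurable]: "\<And>v. (\<lambda>t. blinfun_apply (g t) v) \<in> borel_measurable M"
      and gl: "AE t in M. g t = l t"
    using strongly_measurable_AE_eq_weak[OF assms(3)] by blast
  have [measurable]: "(\<lambda>t. blinfun_apply (A (y t)) v) \<in> borel_measurable M" for v
  proof -
    have "(\<lambda>u. blinfun_apply (A u) v) \<in> borel_measurable borel"
      by (intro borel_measurable_continuous_onI continuous_intros)
    then show ?thesis by measurable
  qed
  have w: "(\<lambda>t. blinfun_apply (g t - A (y t)) v) \<in> borel_measurable M" for v
    unfolding blinfun.diff_left by measurable
  note [measurable] = borel_measurable_ereal_lsc[OF assms(2)]
    borel_measurable_blinfun_apply_weak[OF w assms(5)]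
  have "\<psi> v \<noteq> -\<infinity>" for v using assms(1)[of v] by auto
  note [measurable] = borel_measurable_conjugate[OF this w]
  have "(\<lambda>t. lagrangian \<psi> A g t (y t) (p t)) \<in> borel_measurable M"
    unfolding lagrangian_def by measurable
  moreover have "AE t in M. lagrangian \<psi> A g t (y t) (p t) = lagrangian \<psi> A l t (y t) (p t)"
    using gl by eventually_elim (simp add: lagrangian_def)
  ultimately show thesis using that by blast
qed

section \<open>Vanishing integrals of nonnegative functions\<close>

lemma ereal_integral_nonneg_eq:
  assumes "\<And>t. 0 \<le> f t"
  shows "ereal_integral M f = enn2ereal (\<integral>\<^sup>+ t. e2ennreal (f t) \<partial>M)"
proof -
  have "e2ennreal (- f t) = 0" for t
    using assms[of t] by (simp add: e2ennreal_neg)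
  then show ?thesis by (simp add: ereal_integral_def zero_ennreal.rep_eq)
qed

lemma ereal_integral_eq_0_iff_AE:
  assumes "\<And>t. 0 \<le> f t" and "G \<in> borel_measurable M" and "AE t in M. G t = f t"
  shows "ereal_integral M f = 0 \<longleftrightarrow> (AE t in M. f t = 0)"
proof -
  have "ereal_integral M f = 0 \<longleftrightarrow> (\<integral>\<^sup>+ t. e2ennreal (f t) \<partial>M) = 0"
    unfolding ereal_integral_nonneg_eq[OF assms(1)]
    by (simp flip: zero_ennreal.rep_eq add: enn2ereal_inject)
  \<comment> \<open>The integral depends only on the almost everywhere class, even for a
    non-measurable \<open>f\<close>; measurability of \<open>G\<close> enters in the next
    step.\<close>
  also have "(\<integral>\<^sup>+ t. e2ennreal (f t) \<partial>M) = (\<integral>\<^sup>+ t. e2ennreal (G t) \<partial>M)"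
    using assms(3) by (intro nn_integral_cong_AE) (auto elim: eventually_mono)
  also have "\<dots> = 0 \<longleftrightarrow> (AE t in M. e2ennreal (G t) = 0)"
    using assms(2) by (intro nn_integral_0_iff_AE) measurable
  also have "\<dots> \<longleftrightarrow> (AE t in M. f t = 0)"
  proof -
    \<comment> \<open>\<open>e2ennreal\<close> sends negative values to 0, so this rests on
      \<open>f\<close> being nonnegative.\<close>
    have "e2ennreal (f t) = 0 \<longleftrightarrow> f t = 0" for t
      using assms(1)[of t] by (metis e2ennreal_enn2ereal enn2ereal_e2ennreal zero_ennreal.rep_eq)
    then have "AE t in M. (e2ennreal (G t) = 0) = (f t = 0)"
      using assms(3) by (auto elim: eventually_mono)
    then show ?thesis by (rule eventually_subst)
  qed
  finally show ?thesis .
qed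

text \<open>Membership in \<open>W11 T\<close> provides a witness for the choice in
  \<open>weak_deriv\<close>, and integrability is part of \<open>has_weak_deriv\<close>.\<close>

lemma W11_borel_measurable:
  assumes "y \<in> W11 T"
  shows "y \<in> borel_measurable (lebesgue_on {0<..<T})"
    and "weak_deriv T y \<in> borel_measurable (lebesgue_on {0<..<T})"
proof -
  have "\<exists>g. has_weak_deriv T y g"
    using assms by (simp add: W11_def)
  then have "has_weak_deriv T y (weak_deriv T y)"
    unfolding weak_deriv_def by (rule someI_ex)
  then show "y \<in> borel_measurable (lebesgue_on {0<..<T})"
    and "weak_deriv T y \<in> borel_measurable (lebesgue_on {0<..<T})"
    by (auto simp: has_weak_deriv_def)
qed

theorem theorem3p1:
  fixes T \<alpha> :: real
    and \<psi> :: "'a::{banach, second_countable_topology} \<Rightarrow> ereal"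
    and A :: "'a \<Rightarrow>\<^sub>L 'a dual"
    and l :: "real \<Rightarrow> 'a dual"
    and y0 :: 'a
    and y :: "real \<Rightarrow> 'a"
  assumes "0 < T"
    and "reflexive_space TYPE('a)"
    and "\<And>v. 0 \<le> \<psi> v"
    and "ereal_proper \<psi>"
    and "ereal_convex \<psi>"
    and "ereal_lsc \<psi>"
    and "pos_homogeneous \<psi>"
    and "\<And>u v. blinfun_apply (blinfun_apply A u) v = blinfun_apply (blinfun_apply A v) u"
    and "0 < \<alpha>"
    and "\<And>v. v \<in> eff_domain \<psi> \<Longrightarrow> \<alpha> / 2 * (norm v)\<^sup>2 \<le> energy A v"
    and "\<And>v. 0 \<le> initial_penalty A v"
    and "\<And>v. initial_penalty A v = 0 \<longleftrightarrow> v = 0"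
    and "l \<in> Linfty T"
    and "y0 \<in> eff_domain \<psi>"
    and "y \<in> W11 T"
  shows "solves_evolution T \<psi> A l y0 y \<longleftrightarrow>
    BEN_functional T \<psi> A l y0 y = 0 \<and>
    is_arg_min (BEN_functional T \<psi> A l y0) (\<lambda>z. z \<in> W11 T) y"
proof -
  let ?M = "lebesgue_on {0<..<T}"
  let ?L = "\<lambda>z t. lagrangian \<psi> A l t (z t) (weak_deriv T z t)"
  let ?F = "BEN_functional T \<psi> A l y0"
  have fin: "\<psi> y0 < \<infinity>" using \<open>y0 \<in> eff_domain \<psi>\<close> by (simp add: eff_domain_def)
  have L_nonneg: "0 \<le> ?L z t" for z t
    unfolding lagrangian_def by (rule fenchel_young[of \<psi> y0, OF assms(3) fin])
  have int_nonneg: "0 \<le> ereal_integral ?M (?L z)" for z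
    by (simp add: ereal_integral_nonneg_eq[of "?L z", OF L_nonneg] enn2ereal_nonneg)
  \<comment> \<open>Since this holds for every \<open>z\<close>, a zero value at \<open>y\<close> is
    automatically minimal.\<close>
  have F_nonneg: "0 \<le> ?F z" for z
    unfolding BEN_functional_def using int_nonneg assms(11) by (intro add_nonneg_nonneg) auto
  have "strongly_measurable ?M l" using \<open>l \<in> Linfty T\<close> by (simp add: Linfty_def)
  from lagrangian_AE_eq_measurable[OF assms(3,6) this W11_borel_measurable[OF \<open>y \<in> W11 T\<close>], of A]
  obtain G where G: "G \<in> borel_measurable ?M" "AE t in ?M. G t = ?L y t" .
  have incl: "?L y t = 0 \<longleftrightarrow>
      l t \<in> {\<xi> + blinfun_apply A (y t) | \<xi>. \<xi> \<in> subdiff \<psi> (weak_deriv T y t)}" for t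
    unfolding lagrangian_def fenchel_young_eq_iff_subdiff[of \<psi> y0, OF assms(3) fin]
  proof
    assume "l t - blinfun_apply A (y t) \<in> subdiff \<psi> (weak_deriv T y t)"
    moreover have "l t = (l t - blinfun_apply A (y t)) + blinfun_apply A (y t)" by simp
    ultimately show "l t \<in> {\<xi> + blinfun_apply A (y t) | \<xi>. \<xi> \<in> subdiff \<psi> (weak_deriv T y t)}"
      by blast
  qed auto
  \<comment> \<open>Both summands are nonnegative, so they cannot cancel.\<close>
  have "?F y = 0 \<longleftrightarrow> ereal_integral ?M (?L y) = 0 \<and> initial_penalty A (y 0 - y0) = 0"
    unfolding BEN_functional_def using int_nonneg[of y] assms(11)[of "y 0 - y0"]
    by (cases "ereal_integral ?M (?L y)") auto
  also have "\<dots> \<longleftrightarrow> solves_evolution T \<psi> A l y0 y"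
    \<comment> \<open>Definiteness of the penalty turns its vanishing into the initial condition
      \<open>y 0 = y0\<close>.\<close>
    unfolding ereal_integral_eq_0_iff_AE[of "?L y", OF L_nonneg G] solves_evolution_def incl assms(12) by simp
  finally have "?F y = 0 \<longleftrightarrow> solves_evolution T \<psi> A l y0 y" .
  moreover have "is_arg_min ?F (\<lambda>z. z \<in> W11 T) y" if "?F y = 0"
    using that F_nonneg \<open>y \<in> W11 T\<close> by (auto simp: is_arg_min_def not_less)
  ultimately show ?thesis by blast
qed

end
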